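(* Let $m,n,k$ be positive integers with $k\le\min(m,n)$, let $\mathbf{W}'\in\mathbb{R}^{m\times n}$, let $\delta\ge 0$, and let $\mathbf{I}=(i_{ij})\in\mathbb{R}^{m\times n}$ be an influence matrix, i.e. $i_{ij}\ge 0$ for all $i,j$ and $\frac{1}{mn}\sum_{i,j} i_{ij}=1$. Let $(\mathbf{U}'_k,\boldsymbol{\Sigma}'_k,\mathbf{V}'_k)^{(0)}=\mathrm{SVD}(\mathbf{W}',k)$ be a rank-$k$ truncated singular value decomposition of $\mathbf{W}'$. Consider the sequence of iterates obtained from this initialization by performing, for $r=k-1,k-2,\ldots,0$ in this order, step $r$ of the ALS sweep: the update of $\mathbf{v}'_r$ followed by the update of $(\sigma'_r,\mathbf{u}'_r)$, as defined in the context. Assume that all these updates are well defined, i.e. that all denominators occurring in them are nonzero. Then the influence-weighted objective $\mathcal{L}_{\mathrm{act,infl}}$ is non-increasing along this sequence: for every $r\in\{k-1,\ldots,0\}$, $$\mathcal{L}_{\mathrm{act,infl}}\bigl((\mathbf{U}'_k,\boldsymbol{\Sigma}'_k,\mathbf{V}'_k)_{\text{after step } r}\bigr)\;\le\;\mathcal{L}_{\mathrm{act,infl}}\bigl((\mathbf{U}'_k,\boldsymbol{\Sigma}'_k,\mathbf{V}'_k)_{\text{before step } r}\bigr),$$ with equality if and only if the $r$-th component $(\sigma'_r,\mathbf{u}'_r,\mathbf{v}'_r)$ is, before step $r$, already at the coordinate-wise optimum.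
   Context: Factors. Write $\mathbf{U}'_k=[\mathbf{u}'_0,\ldots,\mathbf{u}'_{k-1}]\in\mathbb{R}^{m\times k}$, $\boldsymbol{\Sigma}'_k=\mathrm{diag}(\sigma'_0,\ldots,\sigma'_{k-1})$, $\mathbf{V}'_k=[\mathbf{v}'_0,\ldots,\mathbf{v}'_{k-1}]\in\mathbb{R}^{n\times k}$, and $\mathbf{W}'_k=\mathbf{U}'_k\boldsymbol{\Sigma}'_k\mathbf{V}'^{\top}_k=\sum_{r=0}^{k-1}\sigma'_r\mathbf{u}'_r\mathbf{v}'^{\top}_r$. $\mathrm{SVD}(\mathbf{W}',k)$ denotes the $k$ leading singular triples of $\mathbf{W}'$, with $\sigma'_0\ge\sigma'_1\ge\cdots\ge\sigma'_{k-1}$ and orthonormal singular vectors. Objective. $$\mathcal{L}_{\mathrm{act,infl}}(\mathbf{U}'_k,\boldsymbol{\Sigma}'_k,\mathbf{V}'_k)=\bigl\|\sqrt{\mathbf{1}+\delta\,\mathbf{I}}\odot(\mathbf{W}'-\mathbf{U}'_k\boldsymbol{\Sigma}'_k\mathbf{V}'^{\top}_k)\bigr\|_F^2=\sum_{i,j}(1+\delta\, i_{ij})\bigl(\mathbf{W}'_{ij}-[\mathbf{U}'_k\boldsymbol{\Sigma}'_k\mathbf{V}'^{\top}_k]_{ij}\bigr)^2,$$ where $\mathbf{1}\in\mathbb{R}^{m\times n}$ is the all-ones matrix, $\odot$ is the entrywise product, and the square root is entrywise. ($\mathbf{I}$ is not the identity matrix.) Step $r$ of the sweep. Given the current factors,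 set $\mathbf{E}_r=\mathbf{W}'-\mathbf{W}'_k+\sigma'_r\mathbf{u}'_r\mathbf{v}'^{\top}_r=\mathbf{W}'-\sum_{j\ne r}\sigma'_j\mathbf{u}'_j\mathbf{v}'^{\top}_j$. (1) Using the current $\mathbf{u}'_r,\sigma'_r$, replace $\mathbf{v}'_r$ by the vector with entries $$v'_{r,j}=\frac{\sum_{i}(1+\delta\, i_{ij})(\mathbf{E}_r)_{ij}\,u'_{r,i}}{\sigma'_r\sum_{i}(1+\delta\, i_{ij})(u'_{r,i})^2},\qquad j=1,\ldots,n.$$ (2) Using the new $\mathbf{v}'_r$ and the same $\mathbf{E}_r$, form $\tilde{\mathbf{u}}'_r\in\mathbb{R}^m$ with entries $$\tilde u'_{r,i}=\frac{\sum_{j}(1+\delta\, i_{ij})(\mathbf{E}_r)_{ij}\,v'_{r,j}}{\sum_{j}(1+\delta\, i_{ij})(v'_{r,j})^2},\qquad i=1,\ldots,m,$$ and replace $\sigma'_r$ by $\|\tilde{\mathbf{u}}'_r\|_2$ and $\mathbf{u}'_r$ by $\tilde{\mathbf{u}}'_r/\|\tilde{\mathbf{u}}'_r\|_2$. All components with index $\ne r$ are left unchanged in step $r$. Coordinate-wise optimum. The component $(\sigma'_r,\mathbf{u}'_r,\mathbf{v}'_r)$ is at the coordinate-wise optimum if, with all components of index $\neq r$ held fixed, (a) $\mathbf{v}'_r$ minimizes $\mathcal{L}_{\mathrm{act,infl}}$ over $\mathbb{R}^n$ with $\sigma'_r,\mathbf{u}'_r$ held fixed, and (b) the vector $\sigma'_r\mathbf{u}'_r$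 minimizes $\mathcal{L}_{\mathrm{act,infl}}$, viewed as a function of $\tilde{\mathbf{u}}'_r=\sigma'_r\mathbf{u}'_r\in\mathbb{R}^m$, with $\mathbf{v}'_r$ held fixed. *)

theory Defs
  imports "HOL-Analysis.Analysis"
begin

text \<open>Matrices with \<open>m\<close> rows and \<open>n\<close> columns have type \<^typ>\<open>real^'n^'m\<close>, with \<open>m = CARD('m)\<close> and
  \<open>n = CARD('n)\<close>; their \<^const>\<open>norm\<close> is the Frobenius norm.  A factorisation \<open>(U, \<Sigma>, V)\<close> with
  \<open>k\<close> components is given by its columns and its diagonal, indexed by natural numbers
  below \<open>k\<close>; values at indices \<open>\<ge> k\<close> are irrelevant.\<close>

type_synonym ('m, 'n) factors =
  "(nat \<Rightarrow> real^'m) \<times> (nat \<Rightarrow> real) \<times> (nat \<Rightarrow> real^'n)"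

definition outer :: "real^'m \<Rightarrow> real^'n \<Rightarrow> real^'n^'m" where
  "outer u v = (\<chi> i j. u $ i * v $ j)"

definition recon :: "nat \<Rightarrow> ('m::finite, 'n::finite) factors \<Rightarrow> real^'n^'m" where
  "recon k = (\<lambda>(U, S, V). \<Sum>r<k. S r *\<^sub>R outer (U r) (V r))"

definition orthonormal_upto :: "nat \<Rightarrow> (nat \<Rightarrow> 'a::real_inner) \<Rightarrow> bool" where
  "orthonormal_upto p u \<longleftrightarrow> (\<forall>a<p. \<forall>b<p. u a \<bullet> u b = (if a = b then 1 else 0))"

text \<open>The thin singular value decomposition, with \<open>min m n\<close> singular triples.\<close>

definition is_svd :: "real^'n^'m \<Rightarrow> ('m::finite, 'n::finite) factors \<Rightarrow> bool" where
  "is_svd W = (\<lambda>(U, S, V).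
     let p = min CARD('m) CARD('n) in
       orthonormal_upto p U \<and> orthonormal_upto p V \<and>
       (\<forall>a<p. 0 \<le> S a) \<and> (\<forall>a<p. \<forall>b<p. a \<le> b \<longrightarrow> S b \<le> S a) \<and>
       W = recon p (U, S, V))"

text \<open>The leading triples need not be unique, so truncated SVD is a relation: any choice of
  the \<open>k\<close> leading triples of an SVD is admitted.\<close>

definition is_truncated_svd ::
    "real^'n^'m \<Rightarrow> nat \<Rightarrow> ('m::finite, 'n::finite) factors \<Rightarrow> bool" where
  "is_truncated_svd W k = (\<lambda>(U, S, V).
     \<exists>U' S' V'. is_svd W (U', S', V') \<and>
       (\<forall>r<k. U r = U' r \<and> S r = S' r \<and> V r = V' r))"

definition influence_matrix :: "real^'n^'m \<Rightarrow> bool" where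
  "influence_matrix A \<longleftrightarrow>
     (\<forall>i j. 0 \<le> A $ i $ j) \<and>
     1 / (real CARD('m) * real CARD('n)) * (\<Sum>i\<in>UNIV. \<Sum>j\<in>UNIV. A $ i $ j) = 1"

definition weight :: "real \<Rightarrow> real^'n^'m \<Rightarrow> real^'n^'m" where
  "weight \<delta> A = (\<chi> i j. 1 + \<delta> * A $ i $ j)"

definition loss ::
    "real \<Rightarrow> real^'n^'m \<Rightarrow> real^'n^'m \<Rightarrow> nat \<Rightarrow> ('m::finite, 'n::finite) factors \<Rightarrow> real" where
  "loss \<delta> A W k F =
     (norm (\<chi> i j. sqrt (weight \<delta> A $ i $ j) * (W - recon k F) $ i $ j))\<^sup>2"

lemma loss_eq_sum:
  fixes A W :: "real^'n^'m"
  assumes "\<delta> \<ge> 0" "influence_matrix A"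
  shows "loss \<delta> A W k F =
    (\<Sum>i\<in>UNIV. \<Sum>j\<in>UNIV. (1 + \<delta> * A $ i $ j) * (W $ i $ j - recon k F $ i $ j)\<^sup>2)"
proof -
  have *: "0 \<le> weight \<delta> A $ i $ j" for i j
    using assms by (simp add: weight_def influence_matrix_def)
  show ?thesis
    unfolding loss_def
    by (simp add: power2_norm_eq_inner inner_vec_def power2_eq_square[symmetric]
        power_mult_distrib * ) (simp add: weight_def)
qed

definition residual ::
    "real^'n^'m \<Rightarrow> nat \<Rightarrow> ('m::finite, 'n::finite) factors \<Rightarrow> nat \<Rightarrow> real^'n^'m" where
  "residual W k = (\<lambda>(U, S, V) r. W - recon k (U, S, V) + S r *\<^sub>R outer (U r) (V r))"

lemma residual_eq:
  assumes "r < k"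
  shows "residual W k (U, S, V) r = W - (\<Sum>j\<in>{..<k} - {r}. S j *\<^sub>R outer (U j) (V j))"
  using assms by (simp add: residual_def recon_def sum.remove[of "{..<k}" r])

definition v_denom :: "real^'n^'m \<Rightarrow> real \<Rightarrow> real^'m \<Rightarrow> 'n \<Rightarrow> real" where
  "v_denom w \<sigma> u j = \<sigma> * (\<Sum>i\<in>UNIV. w $ i $ j * (u $ i)\<^sup>2)"

definition v_update :: "real^'n^'m \<Rightarrow> real^'n^'m \<Rightarrow> real \<Rightarrow> real^'m \<Rightarrow> real^'n" where
  "v_update w E \<sigma> u = (\<chi> j. (\<Sum>i\<in>UNIV. w $ i $ j * E $ i $ j * u $ i) / v_denom w \<sigma> u j)"

definition u_denom :: "real^'n^'m \<Rightarrow> real^'n \<Rightarrow> 'm \<Rightarrow> real" where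
  "u_denom w v i = (\<Sum>j\<in>UNIV. w $ i $ j * (v $ j)\<^sup>2)"

definition u_update :: "real^'n^'m \<Rightarrow> real^'n^'m \<Rightarrow> real^'n \<Rightarrow> real^'m" where
  "u_update w E v = (\<chi> i. (\<Sum>j\<in>UNIV. w $ i $ j * E $ i $ j * v $ j) / u_denom w v i)"

definition als_step ::
    "real \<Rightarrow> real^'n^'m \<Rightarrow> real^'n^'m \<Rightarrow> nat \<Rightarrow> nat \<Rightarrow>
     ('m::finite, 'n::finite) factors \<Rightarrow> ('m, 'n) factors" where
  "als_step \<delta> A W k r = (\<lambda>(U, S, V).
     let w = weight \<delta> A;
         E = residual W k (U, S, V) r;
         v = v_update w E (S r) (U r);
         ut = u_update w E v
     in (U(r := ut /\<^sub>R norm ut), S(r := norm ut), V(r := v)))"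

text \<open>Division by zero yields zero, so the denominators have to be constrained explicitly.\<close>

definition step_well_defined ::
    "real \<Rightarrow> real^'n^'m \<Rightarrow> real^'n^'m \<Rightarrow> nat \<Rightarrow> nat \<Rightarrow>
     ('m::finite, 'n::finite) factors \<Rightarrow> bool" where
  "step_well_defined \<delta> A W k r = (\<lambda>(U, S, V).
     let w = weight \<delta> A;
         E = residual W k (U, S, V) r;
         v = v_update w E (S r) (U r);
         ut = u_update w E v
     in (\<forall>j. v_denom w (S r) (U r) j \<noteq> 0) \<and> (\<forall>i. u_denom w v i \<noteq> 0) \<and> norm ut \<noteq> 0)"

text \<open>The steps are performed in the order \<open>k - 1, k - 2, \<dots>, 0\<close>: before step \<open>r\<close>, the steps
  \<open>k - 1, \<dots>, r + 1\<close> have been performed.\<close>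

definition after_step ::
    "real \<Rightarrow> real^'n^'m \<Rightarrow> real^'n^'m \<Rightarrow> nat \<Rightarrow>
     ('m::finite, 'n::finite) factors \<Rightarrow> nat \<Rightarrow> ('m, 'n) factors" where
  "after_step \<delta> A W k F0 r = fold (als_step \<delta> A W k) (rev [r..<k]) F0"

definition before_step ::
    "real \<Rightarrow> real^'n^'m \<Rightarrow> real^'n^'m \<Rightarrow> nat \<Rightarrow>
     ('m::finite, 'n::finite) factors \<Rightarrow> nat \<Rightarrow> ('m, 'n) factors" where
  "before_step \<delta> A W k F0 r = fold (als_step \<delta> A W k) (rev [Suc r..<k]) F0"

lemma after_step_eq:
  "r < k \<Longrightarrow> after_step \<delta> A W k F0 r = als_step \<delta> A W k r (before_step \<delta> A W k F0 r)"
  by (simp add: after_step_def before_step_def upt_conv_Cons)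

lemma before_step_last: "before_step \<delta> A W (Suc k) F0 k = F0"
  by (simp add: before_step_def)

lemma before_step_eq:
  "before_step \<delta> A W k F0 r = after_step \<delta> A W k F0 (Suc r)"
  by (simp add: after_step_def before_step_def)

text \<open>The loss depends on \<open>\<sigma>\<^sub>r\<close> and \<open>u\<^sub>r\<close> only through \<open>\<sigma>\<^sub>r u\<^sub>r\<close>; as a function of this vector \<open>y\<close>
  it is evaluated at the representation \<open>\<sigma>\<^sub>r = 1\<close>, \<open>u\<^sub>r = y\<close>.\<close>

definition coordinatewise_optimum ::
    "real \<Rightarrow> real^'n^'m \<Rightarrow> real^'n^'m \<Rightarrow> nat \<Rightarrow> nat \<Rightarrow>
     ('m::finite, 'n::finite) factors \<Rightarrow> bool" where
  "coordinatewise_optimum \<delta> A W k r = (\<lambda>(U, S, V).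
     (\<forall>x. loss \<delta> A W k (U, S, V) \<le> loss \<delta> A W k (U, S, V(r := x))) \<and>
     (\<forall>y. loss \<delta> A W k (U(r := S r *\<^sub>R U r), S(r := 1), V)
            \<le> loss \<delta> A W k (U(r := y), S(r := 1), V)))"

lemma loss_absorb_sigma:
  "loss \<delta> A W k (U(r := S r *\<^sub>R U r), S(r := 1), V) = loss \<delta> A W k (U, S, V)"
proof -
  have "recon k (U(r := S r *\<^sub>R U r), S(r := 1), V) = recon k (U, S, V)"
    unfolding recon_def prod.case
    by (rule sum.cong) (auto simp: outer_def vec_eq_iff)
  then show ?thesis by (simp add: loss_def)
qed

end

theory Submission
  imports Defs
begin

text \<open>With all other components fixed, the loss is \<open>\<Sum>\<^sub>i\<^sub>j w\<^sub>i\<^sub>j (E\<^sub>i\<^sub>j - y\<^sub>i x\<^sub>j)\<^sup>2\<close> in terms of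
  \<open>y = \<sigma>\<^sub>r u\<^sub>r\<close> and \<open>x = v\<^sub>r\<close>.  For fixed \<open>y\<close> it splits into one scalar quadratic in each \<open>x\<^sub>j\<close>,
  with nonzero, hence positive, leading coefficient; completing the square shows that the update of
  \<open>x\<close> is its unique minimiser, and symmetrically for \<open>y\<close>.  Hence the loss cannot increase, and by
  uniqueness it is preserved exactly when both updates change nothing.\<close>

text \<open>\<open>t0\<close> solves the normal equation, so the residual
  \<open>e i - a i * t0\<close> is orthogonal to \<open>a\<close> under the weights
  \<open>w\<close>. Expanding the square around \<open>t0\<close>, the cross term therefore
  vanishes.\<close>

lemma weighted_least_squares_decomp:
  fixes w e a :: "'i::finite \<Rightarrow> real"
  defines "D \<equiv> \<Sum>i\<in>UNIV. w i * (a i)\<^sup>2"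
  defines "t0 \<equiv> (\<Sum>i\<in>UNIV. w i * e i * a i) / D"
  assumes "D \<noteq> 0"
  shows "(\<Sum>i\<in>UNIV. w i * (e i - a i * t)\<^sup>2) =
    (\<Sum>i\<in>UNIV. w i * (e i - a i * t0)\<^sup>2) + D * (t - t0)\<^sup>2"
proof -
  have "(\<Sum>i\<in>UNIV. w i * (e i - a i * t0) * a i) = (\<Sum>i\<in>UNIV. w i * e i * a i) - D * t0"
    by (simp add: D_def sum_distrib_left sum_subtractf power2_eq_square algebra_simps)
  also have "\<dots> = 0"
    using assms(3) by (simp add: t0_def)
  finally have orth: "(\<Sum>i\<in>UNIV. w i * (e i - a i * t0) * a i) = 0" .
  have "w i * (e i - a i * t)\<^sup>2 = w i * (e i - a i * t0)\<^sup>2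
      - 2 * (t - t0) * (w i * (e i - a i * t0) * a i) + w i * (a i)\<^sup>2 * (t - t0)\<^sup>2" for i
    by (simp add: power2_eq_square algebra_simps)
  then show ?thesis
    by (simp add: sum.distrib sum_subtractf sum_distrib_left[symmetric] sum_distrib_right[symmetric]
        orth D_def)
qed

text \<open>Each \<open>x j\<close> enters only the inner sum with index \<open>j\<close>, so the
  scalar decomposition applies for every \<open>j\<close> separately. The gap is a sum of squares
  with positive coefficients, which yields minimality and uniqueness together.\<close>

lemma separable_least_squares:
  fixes w e :: "'i::finite \<Rightarrow> 'j::finite \<Rightarrow> real" and a :: "'i \<Rightarrow> real" and x z :: "'j \<Rightarrow> real"
  assumes nonneg: "\<And>i j. 0 \<le> w i j"
    and D: "\<And>j. (\<Sum>i\<in>UNIV. w i j * (a i)\<^sup>2) \<noteq> 0"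
    and z: "\<And>j. z j = (\<Sum>i\<in>UNIV. w i j * e i j * a i) / (\<Sum>i\<in>UNIV. w i j * (a i)\<^sup>2)"
  shows "(\<Sum>j\<in>UNIV. \<Sum>i\<in>UNIV. w i j * (e i j - a i * z j)\<^sup>2)
      \<le> (\<Sum>j\<in>UNIV. \<Sum>i\<in>UNIV. w i j * (e i j - a i * x j)\<^sup>2)" (is "?M \<le> ?L")
    and "(\<Sum>j\<in>UNIV. \<Sum>i\<in>UNIV. w i j * (e i j - a i * z j)\<^sup>2)
      = (\<Sum>j\<in>UNIV. \<Sum>i\<in>UNIV. w i j * (e i j - a i * x j)\<^sup>2) \<longleftrightarrow> x = z"
proof -
  define d where "d j = (\<Sum>i\<in>UNIV. w i j * (a i)\<^sup>2)" for j
  have "0 \<le> d j" for j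
    unfolding d_def by (intro sum_nonneg mult_nonneg_nonneg nonneg) simp
  with D have pos: "0 < d j" for j
    unfolding d_def by (simp add: order_less_le)
  have L: "?L = ?M + (\<Sum>j\<in>UNIV. d j * (x j - z j)\<^sup>2)"
    unfolding d_def sum.distrib[symmetric] z by (intro sum.cong weighted_least_squares_decomp D refl)
  have term_nonneg: "0 \<le> d j * (x j - z j)\<^sup>2" for j
    using pos[of j] by simp
  then show "?M \<le> ?L"
    unfolding L by (simp add: sum_nonneg)
  have "?M = ?L \<longleftrightarrow> (\<Sum>j\<in>UNIV. d j * (x j - z j)\<^sup>2) = 0"
    unfolding L by simp
  also have "\<dots> \<longleftrightarrow> (\<forall>j. x j = z j)"
    using term_nonneg pos by (simp add: sum_nonneg_eq_0_iff less_imp_neq[symmetric])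
  finally show "?M = ?L \<longleftrightarrow> x = z"
    by (simp add: fun_eq_iff)
qed

text \<open>Here \<open>y\<close> stands for the product of \<open>\<sigma>\<^sub>r\<close> and
  \<open>u\<^sub>r\<close>. Columns are summed outermost, the shape in which minimisation over
  \<open>x\<close> separates.\<close>

definition rank1_loss ::
    "real^'n^'m \<Rightarrow> real^'n^'m \<Rightarrow> real^'m \<Rightarrow> real^'n \<Rightarrow> real" where
  "rank1_loss w E y x = (\<Sum>j\<in>UNIV. \<Sum>i\<in>UNIV. w $ i $ j * (E $ i $ j - y $ i * x $ j)\<^sup>2)"

text \<open>The residual involves only the components other than \<open>r\<close>, so one matrix
  serves for every replacement of the triple \<open>r\<close>: before, within and after the
  step.\<close>

lemma loss_update_component:
  fixes A W :: "real^'n^'m" and U :: "nat \<Rightarrow> real^'m::finite" and V :: "nat \<Rightarrow> real^'n::finite"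
  assumes "0 \<le> \<delta>" "influence_matrix A" "r < k"
  shows "loss \<delta> A W k (U(r := u), S(r := s), V(r := v)) =
    rank1_loss (weight \<delta> A) (residual W k (U, S, V) r) (s *\<^sub>R u) v"
proof -
  have "recon k (U(r := u), S(r := s), V(r := v)) =
      s *\<^sub>R outer u v + (\<Sum>j\<in>{..<k} - {r}. S j *\<^sub>R outer (U j) (V j))"
    using assms(3) by (simp add: recon_def sum.remove[of "{..<k}" r])
  then have "W - recon k (U(r := u), S(r := s), V(r := v)) =
      residual W k (U, S, V) r - s *\<^sub>R outer u v"
    using assms(3) by (simp add: residual_eq)
  then have "W $ i $ j - recon k (U(r := u), S(r := s), V(r := v)) $ i $ j =
      residual W k (U, S, V) r $ i $ j - (s *\<^sub>R u) $ i * v $ j" for i j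
    by (simp add: vec_eq_iff outer_def mult.assoc)
  then show ?thesis
    unfolding loss_eq_sum[OF assms(1,2)] rank1_loss_def weight_def
    by (subst sum.swap) simp
qed

lemma v_update_minimizes:
  fixes w :: "real^'n::finite^'m::finite"
  assumes nonneg: "\<And>i j. 0 \<le> w $ i $ j" and D: "\<And>j. v_denom w s u j \<noteq> 0"
  shows "rank1_loss w E (s *\<^sub>R u) (v_update w E s u) \<le> rank1_loss w E (s *\<^sub>R u) x"
    and "rank1_loss w E (s *\<^sub>R u) (v_update w E s u) = rank1_loss w E (s *\<^sub>R u) x
      \<longleftrightarrow> x = v_update w E s u"
proof -
  have s: "s \<noteq> 0"
    using D by (auto simp: v_denom_def)
  \<comment> \<open>With coefficient vector \<open>s *\<^sub>R u\<close> the normal equation has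
    \<open>s\<close> squared in the denominator and \<open>s\<close> in the numerator; cancelling
    one factor leaves the update rule.\<close>
  have den: "(\<Sum>i\<in>UNIV. w $ i $ j * ((s *\<^sub>R u) $ i)\<^sup>2) = s * v_denom w s u j" for j
    by (simp add: v_denom_def sum_distrib_left power2_eq_square algebra_simps)
  have num: "(\<Sum>i\<in>UNIV. w $ i $ j * E $ i $ j * (s *\<^sub>R u) $ i)
      = s * (\<Sum>i\<in>UNIV. w $ i $ j * E $ i $ j * u $ i)" for j
    by (simp add: sum_distrib_left algebra_simps)
  have den0: "(\<Sum>i\<in>UNIV. w $ i $ j * ((s *\<^sub>R u) $ i)\<^sup>2) \<noteq> 0" for j
    unfolding den using s D by simp
  have upd: "v_update w E s u $ j = (\<Sum>i\<in>UNIV. w $ i $ j * E $ i $ j * (s *\<^sub>R u) $ i)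
      / (\<Sum>i\<in>UNIV. w $ i $ j * ((s *\<^sub>R u) $ i)\<^sup>2)" for j
    unfolding num den using s by (simp add: v_update_def)
  note ls = separable_least_squares[where w = "\<lambda>i j. w $ i $ j" and e = "\<lambda>i j. E $ i $ j"
      and a = "\<lambda>i. (s *\<^sub>R u) $ i" and z = "\<lambda>j. v_update w E s u $ j" and x = "\<lambda>j. x $ j",
      OF nonneg den0 upd]
  show "rank1_loss w E (s *\<^sub>R u) (v_update w E s u) \<le> rank1_loss w E (s *\<^sub>R u) x"
    unfolding rank1_loss_def by (rule ls(1))
  show "rank1_loss w E (s *\<^sub>R u) (v_update w E s u) = rank1_loss w E (s *\<^sub>R u) x
      \<longleftrightarrow> x = v_update w E s u"
    unfolding rank1_loss_def ls(2) by (simp add: fun_eq_iff vec_eq_iff)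
qed

lemma u_update_minimizes:
  fixes w :: "real^'n::finite^'m::finite"
  assumes nonneg: "\<And>i j. 0 \<le> w $ i $ j" and D: "\<And>i. u_denom w v i \<noteq> 0"
  shows "rank1_loss w E (u_update w E v) v \<le> rank1_loss w E y v"
proof -
  have den0: "(\<Sum>j\<in>UNIV. w $ i $ j * (v $ j)\<^sup>2) \<noteq> 0" for i
    using D by (simp add: u_denom_def)
  have "(\<Sum>i\<in>UNIV. \<Sum>j\<in>UNIV. w $ i $ j * (E $ i $ j - v $ j * u_update w E v $ i)\<^sup>2)
      \<le> (\<Sum>i\<in>UNIV. \<Sum>j\<in>UNIV. w $ i $ j * (E $ i $ j - v $ j * y $ i)\<^sup>2)"
    by (rule separable_least_squares(1)) (simp_all add: nonneg den0 u_update_def u_denom_def)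
  then show ?thesis
    \<comment> \<open>Minimising over \<open>y\<close> separates by rows, so both double sums are
      reordered.\<close>
    unfolding rank1_loss_def by (subst (1 2) sum.swap) (simp add: mult.commute)
qed

lemma als_step_descent:
  fixes A W :: "real^'n::finite^'m::finite"
  assumes "0 \<le> \<delta>" "influence_matrix A" "r < k" and wd: "step_well_defined \<delta> A W k r F"
  shows "loss \<delta> A W k (als_step \<delta> A W k r F) \<le> loss \<delta> A W k F"
    and "loss \<delta> A W k (als_step \<delta> A W k r F) = loss \<delta> A W k F
      \<longleftrightarrow> coordinatewise_optimum \<delta> A W k r F"
proof -
  obtain U S V where F: "F = (U, S, V)"
    by (cases F)
  define w where "w = weight \<delta> A"
  define E where "E = residual W k F r"
  define x0 where "x0 = v_update w E (S r) (U r)"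
  define y0 where "y0 = u_update w E x0"
  have nonneg: "0 \<le> w $ i $ j" for i j
    using assms(1,2) by (simp add: w_def weight_def influence_matrix_def)
  have vd: "v_denom w (S r) (U r) j \<noteq> 0" and ud: "u_denom w x0 i \<noteq> 0" and y0_nz: "norm y0 \<noteq> 0"
    for i j
    using wd unfolding F step_well_defined_def prod.case Let_def y0_def x0_def E_def w_def by blast+
  note L = loss_update_component[OF assms(1-3), of W U _ S _ V, folded F, folded w_def E_def]
  have before: "loss \<delta> A W k F = rank1_loss w E (S r *\<^sub>R U r) (V r)"
    using L[of "U r" "S r" "V r"] by (simp add: F)
  have step: "loss \<delta> A W k (als_step \<delta> A W k r F) = rank1_loss w E y0 x0"
    \<comment> \<open>Normalisation does not affect the loss: the new scale times the new unit
      vector is \<open>y0\<close> again.\<close>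
    using L[of "y0 /\<^sub>R norm y0" "norm y0" x0] y0_nz
    unfolding F als_step_def prod.case Let_def y0_def x0_def E_def w_def by simp
  have v_var: "loss \<delta> A W k (U, S, V(r := x)) = rank1_loss w E (S r *\<^sub>R U r) x" for x
    using L[of "U r" "S r" x] by simp
  have u_var: "loss \<delta> A W k (U(r := y), S(r := 1), V) = rank1_loss w E y (V r)" for y
    using L[of y 1 "V r"] by simp
  have opt: "coordinatewise_optimum \<delta> A W k r F \<longleftrightarrow>
      (\<forall>x. rank1_loss w E (S r *\<^sub>R U r) (V r) \<le> rank1_loss w E (S r *\<^sub>R U r) x) \<and>
      (\<forall>y. rank1_loss w E (S r *\<^sub>R U r) (V r) \<le> rank1_loss w E y (V r))"
    unfolding coordinatewise_optimum_def F prod.case v_var u_var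
    by (simp add: before[unfolded F])
  note v_min = v_update_minimizes[OF nonneg vd, of E, folded x0_def]
  have u_min: "rank1_loss w E y0 x0 \<le> rank1_loss w E y x0" for y
    unfolding y0_def by (rule u_update_minimizes[OF nonneg ud])
  show "loss \<delta> A W k (als_step \<delta> A W k r F) \<le> loss \<delta> A W k F"
    unfolding step before using u_min v_min(1) by (rule order_trans)
  show "loss \<delta> A W k (als_step \<delta> A W k r F) = loss \<delta> A W k F
      \<longleftrightarrow> coordinatewise_optimum \<delta> A W k r F"
    unfolding step before opt
  proof
    assume eq: "rank1_loss w E y0 x0 = rank1_loss w E (S r *\<^sub>R U r) (V r)"
    \<comment> \<open>The loss between the two updates is squeezed between equal values, so the
      first update gained nothing.\<close>
    then have "rank1_loss w E (S r *\<^sub>R U r) x0 = rank1_loss w E (S r *\<^sub>R U r) (V r)"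
      using u_min[of "S r *\<^sub>R U r"] v_min(1)[of "V r"] by linarith
    then have "V r = x0"
      using v_min(2) by blast
    then show "(\<forall>x. rank1_loss w E (S r *\<^sub>R U r) (V r) \<le> rank1_loss w E (S r *\<^sub>R U r) x) \<and>
        (\<forall>y. rank1_loss w E (S r *\<^sub>R U r) (V r) \<le> rank1_loss w E y (V r))"
      using eq u_min v_min(1) by simp
  next
    assume o: "(\<forall>x. rank1_loss w E (S r *\<^sub>R U r) (V r) \<le> rank1_loss w E (S r *\<^sub>R U r) x) \<and>
        (\<forall>y. rank1_loss w E (S r *\<^sub>R U r) (V r) \<le> rank1_loss w E y (V r))"
    \<comment> \<open>Condition (a) at \<open>x0\<close> makes \<open>V r\<close> a minimiser too,
      so uniqueness identifies them; condition (b) then compares with \<open>y0\<close>.\<close>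
    then have "V r = x0"
      using v_min by (metis order_antisym)
    then show "rank1_loss w E y0 x0 = rank1_loss w E (S r *\<^sub>R U r) (V r)"
      using o u_min by (metis order_antisym)
  qed
qed

theorem propositionA2:
  fixes W A :: "real^'n^'m" and k :: nat and \<delta> :: real
    and F0 :: "('m::finite, 'n::finite) factors"
  assumes "0 < k" and "k \<le> min CARD('m) CARD('n)"
    and "0 \<le> \<delta>"
    and "influence_matrix A"
    and "is_truncated_svd W k F0"
    and "\<forall>r<k. step_well_defined \<delta> A W k r (before_step \<delta> A W k F0 r)"
  shows "\<forall>r<k.
    loss \<delta> A W k (after_step \<delta> A W k F0 r) \<le> loss \<delta> A W k (before_step \<delta> A W k F0 r) \<and>
    (loss \<delta> A W k (after_step \<delta> A W k F0 r) = loss \<delta> A W k (before_step \<delta> A W k F0 r) \<longleftrightarrow>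
       coordinatewise_optimum \<delta> A W k r (before_step \<delta> A W k F0 r))"
  \<comment> \<open>The descent holds from arbitrary factors, so it applies directly to the state
    before each step, without induction along the sweep.\<close>
  using als_step_descent[OF assms(3,4)] assms(6) by (simp add: after_step_eq)

end
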